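(* For all $t=1,\ldots,T$, given the observed history of removals $\mathcal B_1^\star,\ldots,\mathcal B_t^\star$, the algorithm RAM selects $\mathcal A_t$ such that $|\mathcal A_t|\le\alpha_t$, and the following hold. (i) If $f$ is submodular, with curvature $\kappa_f$, then $$\frac{f(\mathcal A_1\setminus\mathcal B_1^\star,\ldots,\mathcal A_t\setminus\mathcal B_t^\star)}{f_t^\star}\ \ge\ \begin{cases}\dfrac{1-e^{-\kappa_f}}{\kappa_f}\,\dfrac{f(\mathcal A_1\setminus\mathcal B_1^\star)}{f(\mathcal M_1)}, & t=1,\\[3mm] \dfrac{1}{1+\kappa_f}\,\dfrac{f(\mathcal A_1\setminus\mathcal B_1^\star,\ldots,\mathcal A_t\setminus\mathcal B_t^\star)}{f(\mathcal M_1,\ldots,\mathcal M_t)}, & t>1.\end{cases}$$ (ii) If $f$ is $c_f$-submodular (i.e. $f$ is monotone with total curvature $c_f$), then $$\frac{f(\mathcal A_1\setminus\mathcal B_1^\star,\ldots,\mathcal A_t\setminus\mathcal B_t^\star)}{f_t^\star}\ \ge\ (1-c_f)\,\frac{f(\mathcal A_1\setminus\mathcal B_1^\star,\ldots,\mathcal A_t\setminus\mathcal B_t^\star)}{f(\mathcal M_1,\ldots,\mathcal M_t)}.$$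
   Context: **Setting.** $T\ge 1$ is an integer; $\mathcal V_1,\ldots,\mathcal V_T$ are finite, pairwise disjoint sets; $\mathcal V=\bigcup_{t=1}^T\mathcal V_t$; $f:2^{\mathcal V}\to\mathbb R$ is non-decreasing with $f(\emptyset)=0$; $\alpha_t,\beta_t$ are integers with $0\le\beta_t\le\alpha_t\le|\mathcal V_t|$. For $\mathcal X_s\subseteq\mathcal V_s$, $f(\mathcal X_1,\ldots,\mathcal X_t)$ denotes $f(\mathcal X_1\cup\cdots\cup\mathcal X_t)$, and $f(v)=f(\{v\})$. **Problem RSM with horizon $t$.** $f_t^\star$ is the optimal value of $$\max_{\mathcal A_1\subseteq\mathcal V_1}\min_{\mathcal B_1\subseteq\mathcal A_1}\cdots\max_{\mathcal A_t\subseteq\mathcal V_t}\min_{\mathcal B_t\subseteq\mathcal A_t} f(\mathcal A_1\setminus\mathcal B_1,\ldots,\mathcal A_t\setminus\mathcal B_t)\quad\text{s.t. } |\mathcal A_s|=\alpha_s,\ |\mathcal B_s|\le\beta_s,\ s=1,\ldots,t.$$ **Algorithm RAM.** At each $t=1,\ldots,T$, having observed the removals $\mathcal B_s\subseteq\mathcal A_s$, $|\mathcal B_s|\le\beta_s$, for $s\le t-1$: (1) sort $\mathcal V_t=\{v_{t,1},\ldots,v_{t,|\mathcal V_t|}\}$ so that $f(v_{t,1})\ge\cdots\ge f(v_{t,|\mathcal V_t|})$ and set $\mathcal S_{t,1}=\{v_{t,1},\ldots,v_{t,\beta_t}\}$; (2) start from $\mathcal S_{t,2}=\emptyset$ and,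 while $|\mathcal S_{t,2}|<\alpha_t-\beta_t$, add to $\mathcal S_{t,2}$ an element $x\in\arg\max_{y\in\mathcal V_t\setminus(\mathcal S_{t,1}\cup\mathcal S_{t,2})} f(\mathcal A_1\setminus\mathcal B_1,\ldots,\mathcal A_{t-1}\setminus\mathcal B_{t-1},\mathcal S_{t,2}\cup\{y\})$; (3) output $\mathcal A_t=\mathcal S_{t,1}\cup\mathcal S_{t,2}$. **Removals.** $\mathcal B_1^\star,\ldots,\mathcal B_T^\star$ are worst-case removals (and are the ones observed by RAM): $\mathcal B_t^\star$ attains $\min_{\mathcal B_t\subseteq\mathcal A_t,\,|\mathcal B_t|\le\beta_t} f(\mathcal A_1\setminus\mathcal B_1^\star,\ldots,\mathcal A_{t-1}\setminus\mathcal B_{t-1}^\star,\mathcal A_t\setminus\mathcal B_t)$. **Failure-free greedy sets $\mathcal M_t$.** With $\mathcal K_t=\mathcal V_t\setminus\mathcal S_{t,1}$ and $\delta_t=\alpha_t-\beta_t$, for $t=1,\ldots,T$ in order: start from $\mathcal M_t=\emptyset$ and, while $|\mathcal M_t|<\delta_t$, add to $\mathcal M_t$ an element of $\arg\max_{y\in\mathcal K_t\setminus\mathcal M_t} f(\mathcal M_1,\ldots,\mathcal M_{t-1},\mathcal M_t\cup\{y\})$. **Submodularity.** $f$ is submodular if $f(\mathcal A\cup\{v\})-f(\mathcal A)\ge f(\mathcal B\cup\{v\})-f(\mathcal B)$ for all $\mathcal A\subseteq\mathcal B\subseteq\mathcal V$ and $v\in\mathcal V$. **Curvature.** For non-decreasing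 submodular $f$ with $f(v)\ne0$ for all $v\in\mathcal V$ (assumed whenever $\kappa_f$ is used), $\kappa_f=1-\min_{v\in\mathcal V}\frac{f(\mathcal V)-f(\mathcal V\setminus\{v\})}{f(v)}\in[0,1]$. The quantity $(1-e^{-\kappa_f})/\kappa_f$ is read as its limit $1$ when $\kappa_f=0$. **Total curvature.** For monotone (non-decreasing) $f$, $c_f=1-\min_{v\in\mathcal V}\min_{\mathcal A,\mathcal B\subseteq\mathcal V\setminus\{v\}}\frac{f(\{v\}\cup\mathcal A)-f(\mathcal A)}{f(\{v\}\cup\mathcal B)-f(\mathcal B)}\in[0,1]$ (equivalently, the smallest $c\in[0,1]$ such that $f(\{v\}\cup\mathcal A)-f(\mathcal A)\ge(1-c)[f(\{v\}\cup\mathcal B)-f(\mathcal B)]$ for all $v$ and all $\mathcal A,\mathcal B\subseteq\mathcal V\setminus\{v\}$). Any monotone $f$ with total curvature $c_f$ is called $c_f$-submodular. Ratios are understood for positive denominators $f_t^\star$, $f(\mathcal M_1,\ldots,\mathcal M_t)$. *)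

theory Defs
  imports Complex_Main "HOL-Library.Disjoint_Sets"
begin

definition ground :: "(nat \<Rightarrow> 'a set) \<Rightarrow> nat \<Rightarrow> 'a set" where
  "ground V T = (\<Union>t\<in>{1..T}. V t)"

definition submodular_on :: "'a set \<Rightarrow> ('a set \<Rightarrow> real) \<Rightarrow> bool" where
  "submodular_on W f \<longleftrightarrow>
     (\<forall>A B v. A \<subseteq> B \<longrightarrow> B \<subseteq> W \<longrightarrow> v \<in> W \<longrightarrow> f (A \<union> {v}) - f A \<ge> f (B \<union> {v}) - f B)"

text \<open>Meaningful only if \<open>W\<close> is finite and nonempty and \<open>f {v} \<noteq> 0\<close> for all \<open>v \<in> W\<close>.\<close>

definition curvature :: "'a set \<Rightarrow> ('a set \<Rightarrow> real) \<Rightarrow> real" where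
  "curvature W f = 1 - Min ((\<lambda>v. (f W - f (W - {v})) / f {v}) ` W)"

text \<open>The quotient \<open>(1 - exp (- k)) / k\<close>, continuously extended to \<open>k = 0\<close>.\<close>

definition curvature_factor :: "real \<Rightarrow> real" where
  "curvature_factor k = (if k = 0 then 1 else (1 - exp (- k)) / k)"

text \<open>The minimum ranges over the quotients with nonzero denominator: in HOL \<open>x / 0 = 0\<close>, so
  admitting a zero denominator would force the value \<open>1\<close>, whereas in the least-constant
  characterisation (see \<open>total_curvature_least\<close> below) such pairs impose no constraint. The value
  is meaningful if \<open>W\<close> is finite and \<open>f\<close> is not constant on the subsets of \<open>W\<close>.\<close>

definition total_curvature :: "'a set \<Rightarrow> ('a set \<Rightarrow> real) \<Rightarrow> real" where
  "total_curvature W f =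
     1 - Min {(f ({v} \<union> A) - f A) / (f ({v} \<union> B) - f B) | v A B.
                v \<in> W \<and> A \<subseteq> W - {v} \<and> B \<subseteq> W - {v} \<and> f ({v} \<union> B) - f B \<noteq> 0}"

lemma total_curvature_least:
  assumes "finite W" "mono_on (Pow W) f" "\<exists>X\<subseteq>W. f X \<noteq> f {}"
  shows "is_arg_min (\<lambda>c. c)
    (\<lambda>c. 0 \<le> c \<and> c \<le> 1 \<and>
      (\<forall>v\<in>W. \<forall>A B. A \<subseteq> W - {v} \<longrightarrow> B \<subseteq> W - {v} \<longrightarrow>
         f ({v} \<union> A) - f A \<ge> (1 - c) * (f ({v} \<union> B) - f B)))
    (total_curvature W f)"
proof -
  define d where "d v A = f ({v} \<union> A) - f A" for v A
  define Q where "Q = {d v A / d v B | v A B. v \<in> W \<and> A \<subseteq> W - {v} \<and> B \<subseteq> W - {v} \<and> d v B \<noteq> 0}"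
  have c: "total_curvature W f = 1 - Min Q"
    by (simp add: total_curvature_def Q_def d_def)
  have nonneg: "d v A \<ge> 0" if "v \<in> W" "A \<subseteq> W - {v}" for v A
  proof -
    have "f A \<le> f ({v} \<union> A)"
      by (rule mono_onD[OF assms(2)]) (use that in auto)
    then show ?thesis by (simp add: d_def)
  qed
  have "Q \<subseteq> (\<lambda>(v, A, B). d v A / d v B) ` (W \<times> Pow W \<times> Pow W)"
    unfolding Q_def by (force simp: image_iff)
  then have fin: "finite Q"
    using assms(1) by (meson finite_SigmaI finite_Pow_iff finite_imageI finite_subset)
  have "\<exists>v\<in>W. \<exists>A\<subseteq>W - {v}. d v A \<noteq> 0"
  proof (rule ccontr)
    assume neg: "\<not> ?thesis"
    have "X \<subseteq> W \<Longrightarrow> f X = f {}" if "finite X" for X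
      using that
    proof induction
      case (insert x F)
      then have "x \<in> W" "F \<subseteq> W - {x}" by auto
      with neg have "d x F = 0" by blast
      with insert show ?case by (simp add: d_def)
    qed simp
    with assms(1,3) show False by (meson finite_subset)
  qed
  then obtain v0 A0 where v0: "v0 \<in> W" "A0 \<subseteq> W - {v0}" "d v0 A0 \<noteq> 0" by blast
  then have "d v0 A0 / d v0 A0 \<in> Q" unfolding Q_def by blast
  with v0 have one: "1 \<in> Q" by simp
  then have "Q \<noteq> {}" by blast
  with fin have minQ: "Min Q \<in> Q" by (rule Min_in)
  have ge: "q \<ge> 0" if "q \<in> Q" for q
    using that nonneg unfolding Q_def by fastforce
  have 1: "d v A \<ge> (1 - (1 - Min Q)) * d v B" if "v \<in> W" "A \<subseteq> W - {v}" "B \<subseteq> W - {v}" for v A B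
  proof (cases "d v B = 0")
    case True
    then show ?thesis using nonneg that by simp
  next
    case False
    then have pos: "d v B > 0" using nonneg[of v B] that by simp
    from False that have "d v A / d v B \<in> Q" unfolding Q_def by blast
    then have "Min Q \<le> d v A / d v B" using fin by simp
    then show ?thesis using pos by (simp add: field_simps)
  qed
  have 2: "1 - Min Q \<le> c"
    if "\<And>v A B. v \<in> W \<Longrightarrow> A \<subseteq> W - {v} \<Longrightarrow> B \<subseteq> W - {v} \<Longrightarrow> d v A \<ge> (1 - c) * d v B" for c
  proof -
    from minQ obtain v A B where m: "Min Q = d v A / d v B" "v \<in> W" "A \<subseteq> W - {v}"
      "B \<subseteq> W - {v}" "d v B \<noteq> 0" unfolding Q_def by blast
    then have "d v B > 0" using nonneg[of v B] by simp
    with that[of v A B] m have "d v A / d v B \<ge> 1 - c" by (simp add: pos_le_divide_eq)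
    with m(1) have "Min Q \<ge> 1 - c" by simp
    then show ?thesis by simp
  qed
  have "Min Q \<le> 1" "Min Q \<ge> 0" using fin one minQ ge by auto
  moreover have "\<forall>v\<in>W. \<forall>A B. A \<subseteq> W - {v} \<longrightarrow> B \<subseteq> W - {v} \<longrightarrow> d v A \<ge> (1 - (1 - Min Q)) * d v B"
    by (intro ballI allI impI 1)
  moreover have "1 - Min Q \<le> c"
    if "\<forall>v\<in>W. \<forall>A B. A \<subseteq> W - {v} \<longrightarrow> B \<subseteq> W - {v} \<longrightarrow> d v A \<ge> (1 - c) * d v B" for c
    by (rule 2) (use that in simp)
  ultimately show ?thesis
    unfolding is_arg_min_def c d_def[symmetric] by (intro conjI notI) (simp, simp, simp, meson not_less)
qed

text \<open>\<open>rsm_value f V \<alpha> \<beta> n s R\<close> is the value of the max-min problem over the \<open>n\<close> remaining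
  stages \<open>s, \<dots>, s + n - 1\<close>, when \<open>R\<close> is what was retained in the earlier stages.\<close>

fun rsm_value ::
  "('a set \<Rightarrow> real) \<Rightarrow> (nat \<Rightarrow> 'a set) \<Rightarrow> (nat \<Rightarrow> nat) \<Rightarrow> (nat \<Rightarrow> nat) \<Rightarrow> nat \<Rightarrow> nat \<Rightarrow> 'a set \<Rightarrow> real"
where
  "rsm_value f V \<alpha> \<beta> 0 s R = f R"
| "rsm_value f V \<alpha> \<beta> (Suc n) s R =
     Max ((\<lambda>A. Min ((\<lambda>B. rsm_value f V \<alpha> \<beta> n (Suc s) (R \<union> (A - B)))
                    ` {B. B \<subseteq> A \<and> card B \<le> \<beta> s}))
          ` {A. A \<subseteq> V s \<and> card A = \<alpha> s})"

definition rsm_opt ::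
  "('a set \<Rightarrow> real) \<Rightarrow> (nat \<Rightarrow> 'a set) \<Rightarrow> (nat \<Rightarrow> nat) \<Rightarrow> (nat \<Rightarrow> nat) \<Rightarrow> nat \<Rightarrow> real" where
  "rsm_opt f V \<alpha> \<beta> t = rsm_value f V \<alpha> \<beta> t 1 {}"

text \<open>The states of the greedy loop that, given \<open>R\<close>, picks elements of \<open>K\<close> while fewer than \<open>d\<close>
  have been picked; ties are broken arbitrarily.\<close>

inductive greedy_state :: "('a set \<Rightarrow> real) \<Rightarrow> 'a set \<Rightarrow> 'a set \<Rightarrow> nat \<Rightarrow> 'a set \<Rightarrow> bool"
  for f R K d where
  start: "greedy_state f R K d {}"
| step: "greedy_state f R K d S \<Longrightarrow> card S < d \<Longrightarrow>
         is_arg_max (\<lambda>y. f (R \<union> (S \<union> {y}))) (\<lambda>y. y \<in> K - S) x \<Longrightarrow>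
         greedy_state f R K d (S \<union> {x})"

definition greedy_output :: "('a set \<Rightarrow> real) \<Rightarrow> 'a set \<Rightarrow> 'a set \<Rightarrow> nat \<Rightarrow> 'a set \<Rightarrow> bool" where
  "greedy_output f R K d S \<longleftrightarrow> greedy_state f R K d S \<and> \<not> card S < d"

definition top_singletons :: "('a set \<Rightarrow> real) \<Rightarrow> 'a set \<Rightarrow> nat \<Rightarrow> 'a set \<Rightarrow> bool" where
  "top_singletons f W b S \<longleftrightarrow>
     (\<exists>vs. distinct vs \<and> set vs = W \<and> sorted_wrt (\<lambda>x y. f {x} \<ge> f {y}) vs \<and> S = set (take b vs))"

text \<open>\<open>S1 t\<close>, \<open>S2 t\<close> and \<open>A t\<close> form a possible execution of step \<open>t\<close> of the algorithm after
  the removals \<open>B s\<close>, \<open>s < t\<close>, have been observed.\<close>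

definition ram_step ::
  "('a set \<Rightarrow> real) \<Rightarrow> (nat \<Rightarrow> 'a set) \<Rightarrow> (nat \<Rightarrow> nat) \<Rightarrow> (nat \<Rightarrow> nat) \<Rightarrow>
   (nat \<Rightarrow> 'a set) \<Rightarrow> (nat \<Rightarrow> 'a set) \<Rightarrow> (nat \<Rightarrow> 'a set) \<Rightarrow> (nat \<Rightarrow> 'a set) \<Rightarrow> nat \<Rightarrow> bool" where
  "ram_step f V \<alpha> \<beta> S1 S2 A B t \<longleftrightarrow>
     top_singletons f (V t) (\<beta> t) (S1 t) \<and>
     greedy_output f (\<Union>s\<in>{1..<t}. A s - B s) (V t - S1 t) (\<alpha> t - \<beta> t) (S2 t) \<and>
     A t = S1 t \<union> S2 t"

definition worst_case_removal ::
  "('a set \<Rightarrow> real) \<Rightarrow> (nat \<Rightarrow> nat) \<Rightarrow> (nat \<Rightarrow> 'a set) \<Rightarrow> (nat \<Rightarrow> 'a set) \<Rightarrow> nat \<Rightarrow> bool" where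
  "worst_case_removal f \<beta> A B t \<longleftrightarrow>
     is_arg_min (\<lambda>X. f ((\<Union>s\<in>{1..<t}. A s - B s) \<union> (A t - X)))
                (\<lambda>X. X \<subseteq> A t \<and> card X \<le> \<beta> t) (B t)"

definition failure_free_greedy ::
  "('a set \<Rightarrow> real) \<Rightarrow> (nat \<Rightarrow> 'a set) \<Rightarrow> (nat \<Rightarrow> nat) \<Rightarrow> (nat \<Rightarrow> nat) \<Rightarrow>
   (nat \<Rightarrow> 'a set) \<Rightarrow> (nat \<Rightarrow> 'a set) \<Rightarrow> nat \<Rightarrow> bool" where
  "failure_free_greedy f V \<alpha> \<beta> S1 M t \<longleftrightarrow>
     greedy_output f (\<Union>s\<in>{1..<t}. M s) (V t - S1 t) (\<alpha> t - \<beta> t) (M t)"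

end

theory Submission
  imports Defs
begin

text \<open>The adversary of the max-min problem can always remove all elements of \<open>S1 s\<close>, so the optimal
  value is at most \<open>f (X\<^sub>1 \<union> \<dots> \<union> X\<^sub>t)\<close> for some \<open>X\<^sub>s \<subseteq> V s - S1 s\<close> of size \<open>\<alpha> s - \<beta> s\<close>. These are
  the candidates of the failure-free greedy procedure, so it remains to compare \<open>f (M\<^sub>1 \<union> \<dots> \<union> M\<^sub>t)\<close>
  with \<open>f (X\<^sub>1 \<union> \<dots> \<union> X\<^sub>t)\<close>, that is, to analyse greedy under a partition matroid constraint
  (and under a cardinality constraint if \<open>t = 1\<close>). Both curvatures \<open>c\<close> enter only through the
  inequality \<open>f (S \<union> {v}) - f S \<ge> (1 - c) (f (S' \<union> {v}) - f S')\<close> for \<open>v \<notin> S, S'\<close>.\<close>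

section \<open>Marginal ratios and the two curvatures\<close>

definition marginal_ratio :: "'a set \<Rightarrow> ('a set \<Rightarrow> real) \<Rightarrow> real \<Rightarrow> bool" where
  "marginal_ratio W f c \<longleftrightarrow>
     (\<forall>v\<in>W. \<forall>Y Z. Y \<subseteq> W - {v} \<longrightarrow> Z \<subseteq> W - {v} \<longrightarrow>
        (1 - c) * (f (Z \<union> {v}) - f Z) \<le> f (Y \<union> {v}) - f Y)"

lemma marginal_ratioD:
  assumes "marginal_ratio W f c" "v \<in> W" "Y \<subseteq> W - {v}" "Z \<subseteq> W - {v}"
  shows "(1 - c) * (f (Z \<union> {v}) - f Z) \<le> f (Y \<union> {v}) - f Y"
  using assms unfolding marginal_ratio_def by blast

lemma mono_on_PowD:
  assumes "mono_on (Pow W) f" "A \<subseteq> B" "B \<subseteq> W"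
  shows "f A \<le> f B"
  by (rule mono_onD[OF assms(1)]) (use assms in auto)

lemma submodular_onD:
  assumes "submodular_on W f" "A \<subseteq> B" "B \<subseteq> W" "v \<in> W"
  shows "f (B \<union> {v}) - f B \<le> f (A \<union> {v}) - f A"
  using assms unfolding submodular_on_def by blast

lemma marginal_ratio_total_curvature:
  assumes "finite W" "mono_on (Pow W) f" "\<exists>X\<subseteq>W. f X \<noteq> f {}"
  shows "marginal_ratio W f (total_curvature W f)" "total_curvature W f \<le> 1"
  using total_curvature_least[OF assms]
  unfolding is_arg_min_def marginal_ratio_def by (simp_all add: Un_commute)

text \<open>By submodularity the marginal of \<open>v\<close> is largest at the empty set, where it
  is \<open>f {v}\<close>, and smallest at \<open>W - {v}\<close>. The curvature compares just these
  two extremes, so any two marginals of \<open>v\<close> lie between them.\<close>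

lemma curvature_bounds:
  assumes "finite W" "W \<noteq> {}" "mono_on (Pow W) f" "submodular_on W f" "f {} = 0"
    "\<forall>v\<in>W. f {v} \<noteq> 0"
  shows "0 \<le> curvature W f" "curvature W f \<le> 1" "marginal_ratio W f (curvature W f)"
proof -
  define Q where "Q = (\<lambda>v. (f W - f (W - {v})) / f {v}) ` W"
  have c: "curvature W f = 1 - Min Q" by (simp add: curvature_def Q_def)
  have fin: "finite Q" "Q \<noteq> {}" using assms(1,2) by (auto simp: Q_def)
  have pos: "f {v} > 0" if "v \<in> W" for v
    using mono_on_PowD[OF assms(3), of "{}" "{v}"] assms(5,6) that by fastforce
  have q: "0 \<le> (f W - f (W - {v})) / f {v} \<and> (f W - f (W - {v})) / f {v} \<le> 1" if "v \<in> W" for v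
  proof -
    have "f (W - {v}) \<le> f W" by (rule mono_on_PowD[OF assms(3)]) auto
    moreover have "f (W - {v} \<union> {v}) - f (W - {v}) \<le> f ({} \<union> {v}) - f {}"
      by (rule submodular_onD[OF assms(4)]) (use that in auto)
    moreover have "W - {v} \<union> {v} = W" using that by auto
    ultimately show ?thesis using pos[OF that] assms(5) by simp
  qed
  have "Min Q \<in> Q" using fin by (rule Min_in)
  then show "0 \<le> curvature W f" "curvature W f \<le> 1" using q unfolding c Q_def by force+
  show "marginal_ratio W f (curvature W f)"
    unfolding marginal_ratio_def
  proof (intro ballI allI impI)
    fix v Y Z assume v: "v \<in> W" and Y: "Y \<subseteq> W - {v}" and Z: "Z \<subseteq> W - {v}"
    have "Min Q \<le> (f W - f (W - {v})) / f {v}" using fin v by (auto simp: Q_def)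
    then have 1: "Min Q * f {v} \<le> f W - f (W - {v})" using pos[OF v] by (simp add: field_simps)
    have 2: "f (W - {v} \<union> {v}) - f (W - {v}) \<le> f (Y \<union> {v}) - f Y"
      by (rule submodular_onD[OF assms(4)]) (use v Y in auto)
    have 3: "W - {v} \<union> {v} = W" using v by auto
    have "f (Z \<union> {v}) - f Z \<le> f ({} \<union> {v}) - f {}"
      by (rule submodular_onD[OF assms(4)]) (use v Z in auto)
    then have "Min Q * (f (Z \<union> {v}) - f Z) \<le> Min Q * f {v}"
      using \<open>curvature W f \<le> 1\<close> assms(5) by (simp add: c mult_left_mono)
    then show "(1 - curvature W f) * (f (Z \<union> {v}) - f Z) \<le> f (Y \<union> {v}) - f Y"
      using 1 2 3 by (simp add: c)
  qed
qed

section \<open>Sizes of the selected sets\<close>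

lemma greedy_state_card:
  assumes "greedy_state f R K d S"
  shows "finite S \<and> S \<subseteq> K \<and> card S \<le> d"
  using assms by induction (auto simp: is_arg_max_def)

lemma greedy_output_card:
  assumes "greedy_output f R K d S"
  shows "finite S" "S \<subseteq> K" "card S = d"
  using assms greedy_state_card unfolding greedy_output_def by (fastforce, fastforce, fastforce)

lemma top_singletons_card:
  assumes "top_singletons f W b S"
  shows "S \<subseteq> W" "finite S" "card S \<le> b"
proof -
  obtain vs where vs: "set vs = W" "S = set (take b vs)"
    using assms unfolding top_singletons_def by blast
  show "S \<subseteq> W" "finite S" using vs by (auto dest: in_set_takeD)
  have "card S \<le> length (take b vs)" unfolding vs(2) by (rule card_length)
  then show "card S \<le> b" by simp
qed

section \<open>Upper bound on the max-min value\<close>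

text \<open>Induction on the number of stages, for arbitrary \<open>R\<close>: the best
  \<open>A\<close> of a stage is answered by a removal that contains \<open>A \<inter> S s\<close>,
  and what is retained serves as \<open>X s\<close> and joins \<open>R\<close> for the later
  stages.\<close>

lemma rsm_value_le:
  assumes "\<And>r. r \<in> {s..<s + n} \<Longrightarrow> finite (V r) \<and> finite (S r) \<and> card (S r) \<le> \<beta> r \<and>
             \<beta> r \<le> \<alpha> r \<and> \<alpha> r \<le> card (V r)"
  shows "\<exists>X. (\<forall>r\<in>{s..<s + n}. X r \<subseteq> V r - S r \<and> card (X r) = \<alpha> r - \<beta> r) \<and>
             rsm_value f V \<alpha> \<beta> n s R \<le> f (R \<union> (\<Union>r\<in>{s..<s + n}. X r))"
  using assms
proof (induction n arbitrary: s R)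
  case 0
  then show ?case by simp
next
  case (Suc n)
  have s: "finite (V s)" "finite (S s)" "card (S s) \<le> \<beta> s" "\<beta> s \<le> \<alpha> s" "\<alpha> s \<le> card (V s)"
    using Suc.prems[of s] by auto
  let ?m = "\<lambda>A. Min ((\<lambda>B. rsm_value f V \<alpha> \<beta> n (Suc s) (R \<union> (A - B))) ` {B. B \<subseteq> A \<and> card B \<le> \<beta> s})"
  let ?As = "{A. A \<subseteq> V s \<and> card A = \<alpha> s}"
  have "finite ?As" using s(1) by simp
  moreover have "?As \<noteq> {}" using obtain_subset_with_card_n[OF s(5)] by blast
  ultimately have "Max (?m ` ?As) \<in> ?m ` ?As" by (intro Max_in) auto
  then obtain A where A: "A \<subseteq> V s" "card A = \<alpha> s" "rsm_value f V \<alpha> \<beta> (Suc n) s R = ?m A"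
    by auto
  have finA: "finite A" using A(1) s(1) finite_subset by blast
  \<comment> \<open>The removal is padded to exactly \<open>\<beta> s\<close> elements, so that the
    retained set has exactly \<open>\<alpha> s - \<beta> s\<close> elements, as many as greedy
    picks.\<close>
  have "card (A \<inter> S s) \<le> \<beta> s" using s(2,3) card_mono[of "S s" "A \<inter> S s"] by auto
  then obtain B where B: "A \<inter> S s \<subseteq> B" "B \<subseteq> A" "card B = \<beta> s"
    using exists_subset_between[of "A \<inter> S s" "\<beta> s" A] A(2) s(4) finA by auto
  have "?m A \<le> rsm_value f V \<alpha> \<beta> n (Suc s) (R \<union> (A - B))"
    using B finA by (intro Min_le) auto
  moreover obtain X where X: "\<forall>r\<in>{Suc s..<Suc s + n}. X r \<subseteq> V r - S r \<and> card (X r) = \<alpha> r - \<beta> r"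
    "rsm_value f V \<alpha> \<beta> n (Suc s) (R \<union> (A - B)) \<le> f (R \<union> (A - B) \<union> (\<Union>r\<in>{Suc s..<Suc s + n}. X r))"
    using Suc.IH[of "Suc s" "R \<union> (A - B)"] Suc.prems by auto
  moreover define X' where "X' = X(s := A - B)"
  moreover have "R \<union> (A - B) \<union> (\<Union>r\<in>{Suc s..<Suc s + n}. X r) = R \<union> (\<Union>r\<in>{s..<s + Suc n}. X' r)"
  proof -
    have "{s..<s + Suc n} = insert s {Suc s..<Suc s + n}" by auto
    moreover have "(\<Union>r\<in>{Suc s..<Suc s + n}. X' r) = (\<Union>r\<in>{Suc s..<Suc s + n}. X r)"
      by (auto simp: X'_def)
    ultimately show ?thesis by (auto simp: X'_def)
  qed
  moreover have "\<forall>r\<in>{s..<s + Suc n}. X' r \<subseteq> V r - S r \<and> card (X' r) = \<alpha> r - \<beta> r"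
  proof
    fix r assume r: "r \<in> {s..<s + Suc n}"
    have "card (A - B) = \<alpha> s - \<beta> s"
      using card_Diff_subset[of B A] B finA A(2) finite_subset by metis
    then show "X' r \<subseteq> V r - S r \<and> card (X' r) = \<alpha> r - \<beta> r"
      using X(1) r A(1) B by (cases "r = s") (auto simp: X'_def)
  qed
  ultimately show ?case using A(3) by (intro exI[of _ X']) auto
qed

section \<open>Greedy within one block\<close>

text \<open>Each greedy pick is charged with one element of \<open>X\<close> that was still
  available to it. The marginals of that element over the greedy set and over the part of
  \<open>X\<close> added to \<open>Q\<close> so far are comparable up to the factor
  \<open>1 - c\<close>.\<close>

lemma greedy_state_marginal_ratio:
  assumes "greedy_state f R K d S" and "marginal_ratio W f c" "c \<le> 1"
    and "K \<union> R \<union> Q \<subseteq> W" "R \<inter> K = {}" "Q \<inter> K = {}"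
    and "X \<subseteq> K" "finite X" "card X = card S"
  shows "(1 - c) * (f (Q \<union> X) - f Q) \<le> f (R \<union> S) - f R"
  using assms(1,7-9)
proof (induction arbitrary: X)
  case start
  then show ?case by simp
next
  case (step S x)
  have S: "finite S" "S \<subseteq> K" using greedy_state_card[OF step.hyps(1)] by auto
  have x: "x \<in> K" "x \<notin> S" and max: "\<And>y. y \<in> K - S \<Longrightarrow> f (R \<union> (S \<union> {y})) \<le> f (R \<union> (S \<union> {x}))"
    using step.hyps(3) by (auto simp: is_arg_max_def not_less)
  have cX: "card X = Suc (card S)" using step.prems(3) S x by simp
  \<comment> \<open>As \<open>X\<close> is larger than \<open>S\<close>, some \<open>y\<close> in
    \<open>X\<close> has not been picked; it lies outside both sets whose marginals are
    compared.\<close>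
  have "\<not> X \<subseteq> S" using cX S card_mono[of S X] by auto
  then obtain y where y: "y \<in> X" "y \<notin> S" by blast
  have yK: "y \<in> K" using y step.prems(1) by blast
  have "(1 - c) * (f (Q \<union> (X - {y})) - f Q) \<le> f (R \<union> S) - f R"
    using step.prems cX y by (intro step.IH) auto
  moreover have "(1 - c) * (f (Q \<union> (X - {y}) \<union> {y}) - f (Q \<union> (X - {y})))
      \<le> f (R \<union> S \<union> {y}) - f (R \<union> S)"
    using assms(4-6) yK y S step.prems(1) by (intro marginal_ratioD[OF assms(2)]) auto
  moreover have "Q \<union> (X - {y}) \<union> {y} = Q \<union> X" using y by auto
  moreover have "f (R \<union> S \<union> {y}) \<le> f (R \<union> (S \<union> {x}))" using max[of y] yK y by (simp add: Un_assoc)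
  ultimately show ?case by (simp add: algebra_simps)
qed

text \<open>The witness \<open>g\<close> is the total greedy gain of the picks outside
  \<open>X\<close>. These picks pay for the elements of \<open>X - S\<close>, which bounds the gain
  of adding \<open>X\<close>. If \<open>Y \<inter> S \<subseteq> X\<close>, they also lie outside
  \<open>Y\<close>, so adding \<open>S\<close> to \<open>Y\<close> gains at least
  \<open>(1 - c) * g\<close>.\<close>

lemma greedy_state_submodular:
  assumes "greedy_state f R K d S" and "marginal_ratio W f c" "c \<le> 1"
    and mono: "mono_on (Pow W) f" and sub: "submodular_on W f"
    and "K \<union> R \<subseteq> W" "R \<inter> K = {}"
    and "X \<subseteq> K" "finite X" "card X = card S"
  shows "\<exists>g. g \<le> f (R \<union> S) - f R \<and>
    (\<forall>Z. R \<union> S \<subseteq> Z \<longrightarrow> Z \<subseteq> W \<longrightarrow> f (Z \<union> X) - f Z \<le> g) \<and>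
    (\<forall>Y. Y \<subseteq> W \<longrightarrow> Y \<inter> S \<subseteq> X \<longrightarrow> (1 - c) * g \<le> f (Y \<union> S) - f Y)"
  using assms(1,8-10)
proof (induction arbitrary: X)
  case start
  then show ?case by (intro exI[of _ 0]) simp
next
  case (step S x)
  have S: "finite S" "S \<subseteq> K" using greedy_state_card[OF step.hyps(1)] by auto
  have x: "x \<in> K" "x \<notin> S" and max: "\<And>y. y \<in> K - S \<Longrightarrow> f (R \<union> (S \<union> {y})) \<le> f (R \<union> (S \<union> {x}))"
    using step.hyps(3) by (auto simp: is_arg_max_def not_less)
  have cX: "card X = Suc (card S)" using step.prems(3) S x by simp
  \<comment> \<open>A pick that belongs to \<open>X\<close> is paired with itself; it then costs
    nothing, since \<open>Z\<close> already contains it, and its gain stays out of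
    \<open>g'\<close>.\<close>
  obtain y where y: "y \<in> X" "y \<notin> S" "x \<in> X \<Longrightarrow> y = x"
  proof (cases "x \<in> X")
    case False
    have "\<not> X \<subseteq> S" using cX S card_mono[of S X] by auto
    then show ?thesis using False that by blast
  qed (use x that in blast)
  have yK: "y \<in> K" using y step.prems(1) by blast
  obtain g where g: "g \<le> f (R \<union> S) - f R"
    and gZ: "\<And>Z. R \<union> S \<subseteq> Z \<Longrightarrow> Z \<subseteq> W \<Longrightarrow> f (Z \<union> (X - {y})) - f Z \<le> g"
    and gY: "\<And>Y. Y \<subseteq> W \<Longrightarrow> Y \<inter> S \<subseteq> X - {y} \<Longrightarrow> (1 - c) * g \<le> f (Y \<union> S) - f Y"
    proof -
    have "X - {y} \<subseteq> K" "finite (X - {y})" "card (X - {y}) = card S"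
      using step.prems cX y by auto
    from step.IH[OF this] show ?thesis using that by blast
  qed
  define h where "h = f (R \<union> (S \<union> {x})) - f (R \<union> S)"
  define g' where "g' = (if x \<in> X then g else g + h)"
  have h0: "h \<ge> 0"
    unfolding h_def using mono_on_PowD[OF mono, of "R \<union> S" "R \<union> (S \<union> {x})"] assms(6) S x by auto
  have "g' \<le> f (R \<union> (S \<union> {x})) - f R" using g h0 by (simp add: g'_def h_def)
  moreover have "f (Z \<union> X) - f Z \<le> g'" if Z: "R \<union> (S \<union> {x}) \<subseteq> Z" "Z \<subseteq> W" for Z
  proof (cases "x \<in> X")
    case True
    then have "Z \<union> X = Z \<union> (X - {y})" using y Z by auto
    then show ?thesis using gZ[of Z] Z True by (auto simp: g'_def)
  next
    case False
    have Zy: "Z \<union> (X - {y}) \<union> {y} = Z \<union> X" using y by auto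
    have "f (Z \<union> (X - {y}) \<union> {y}) - f (Z \<union> (X - {y})) \<le> f (R \<union> S \<union> {y}) - f (R \<union> S)"
      using Z step.prems(1) assms(6) yK by (intro submodular_onD[OF sub]) auto
    also have "\<dots> \<le> h" using max[of y] yK y by (simp add: h_def Un_assoc)
    finally show ?thesis using gZ[of Z] Z False Zy by (simp add: g'_def)
  qed
  moreover have "(1 - c) * g' \<le> f (Y \<union> (S \<union> {x})) - f Y" 
    if Y: "Y \<subseteq> W" "Y \<inter> (S \<union> {x}) \<subseteq> X" for Y
  proof -
    have IH: "(1 - c) * g \<le> f (Y \<union> S) - f Y" using Y y by (intro gY) auto
    show ?thesis
    proof (cases "x \<in> X")
      case True
      have "f (Y \<union> S) \<le> f (Y \<union> (S \<union> {x}))"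
        using Y S x assms(6) by (intro mono_on_PowD[OF mono]) auto
      then show ?thesis using IH True by (simp add: g'_def)
    next
      case False
      have "(1 - c) * (f (R \<union> S \<union> {x}) - f (R \<union> S)) \<le> f (Y \<union> S \<union> {x}) - f (Y \<union> S)"
        using Y S x assms(6,7) False by (intro marginal_ratioD[OF assms(2)]) auto
      then show ?thesis using IH False by (simp add: g'_def h_def Un_assoc algebra_simps)
    qed
  qed
  ultimately show ?case by (intro exI[of _ g']) blast
qed

section \<open>Exponential estimates for a single greedy step\<close>

text \<open>At \<open>z = 1\<close> this is \<open>curvature_factor c\<close> for
  \<open>c \<noteq> 0\<close>. For \<open>z = n / p\<close> it is the fraction of a deficit
  \<open>D\<close> gained in time \<open>n\<close> by the continuous process with gain rate
  \<open>D / p\<close> in which \<open>D\<close> falls at \<open>c\<close> times that rate.\<close>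

definition exp_ratio :: "real \<Rightarrow> real \<Rightarrow> real" where
  "exp_ratio c z = (1 - exp (- c * z)) / c"

lemma exp_ratio_le:
  assumes "0 < c"
  shows "exp_ratio c z \<le> z"
proof -
  have "1 - exp (- c * z) \<le> c * z" using exp_ge_add_one_self[of "- c * z"] by simp
  then show ?thesis using assms by (simp add: exp_ratio_def field_simps)
qed

text \<open>A greedy step with gain \<open>r\<close> outside of the reference set, with \<open>n\<close> steps left,
  \<open>p\<close> elements of the reference set left, and a deficit \<open>D\<close>.\<close>

lemma exp_ratio_step_outside:
  assumes "0 < c" "0 < p" "0 \<le> D" "D \<le> p * r"
  shows "D * exp_ratio c (n / p) \<le> r + (D - c * r) * exp_ratio c ((n - 1) / p)"
proof -
  define E where "E = exp (- c * ((n - 1) / p))"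
  have E: "E > 0" by (simp add: E_def)
  \<comment> \<open>Splitting off one step contributes \<open>c / p\<close> to the exponent; its
    exponential is bounded by the tangent, and \<open>D / p\<close> is then replaced by
    \<open>r\<close>.\<close>
  have "- c * (n / p) = - c / p + (- c * ((n - 1) / p))"
    using assms(2) by (simp add: field_simps)
  then have nE: "exp (- c * (n / p)) = exp (- c / p) * E" by (simp only: exp_add E_def)
  have "(1 - c / p) * E \<le> exp (- c / p) * E"
    using E exp_ge_add_one_self[of "- c / p"] by (intro mult_right_mono) auto
  then have "D * (1 - exp (- c * (n / p))) \<le> D * (1 - (1 - c / p) * E)"
    unfolding nE using assms(3) by (intro mult_left_mono) auto
  also have "\<dots> = D * (1 - E) + (D / p) * c * E" using assms(2) by (simp add: field_simps)
  also have "\<dots> \<le> D * (1 - E) + r * c * E"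
    using assms E by (intro add_left_mono mult_right_mono) (auto simp: field_simps)
  also have "\<dots> = c * r + (D - c * r) * (1 - E)" by algebra
  finally have "D * (1 - exp (- c * (n / p))) / c \<le> (c * r + (D - c * r) * (1 - E)) / c"
    using assms(1) by (intro divide_right_mono) auto
  also have "\<dots> = r + (D - c * r) * ((1 - E) / c)" using assms(1) by (simp add: add_divide_distrib)
  finally show ?thesis by (simp add: exp_ratio_def E_def)
qed

text \<open>For \<open>p = 1\<close>, the quotient \<open>(n - 1) / (p - 1)\<close> is \<open>0\<close>.\<close>

lemma exp_ratio_step_inside:
  assumes "0 < c" "c \<le> 1" "1 \<le> n" "n \<le> p" "0 \<le> D" "D \<le> p * r"
  shows "D * exp_ratio c (n / p) \<le> r + (D - r) * exp_ratio c ((n - 1) / (p - 1))"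
proof -
  \<comment> \<open>With \<open>y\<close> as the new quotient,
    \<open>n / p = y + (1 - y) / p\<close>, and \<open>n \<le> p\<close> gives
    \<open>y \<le> 1\<close>.\<close>
  define y where "y = (n - 1) / (p - 1)"
  define E where "E = exp (- c * y)"
  have p: "p \<ge> 1" using assms by simp
  have y: "0 \<le> y" "y \<le> 1" using assms by (auto simp: y_def divide_le_eq)
  have n: "n = 1 + (p - 1) * y" using assms by (auto simp: y_def)
  have E: "E > 0" by (simp add: E_def)
  have "- c * (n / p) = - c * ((1 - y) / p) + (- c * y)"
    unfolding n using p by (simp add: field_simps)
  then have nE: "exp (- c * (n / p)) = exp (- c * ((1 - y) / p)) * E" by (simp only: exp_add E_def)
  have "(1 - c * ((1 - y) / p)) * E \<le> exp (- c * (n / p))"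
    unfolding nE using E exp_ge_add_one_self[of "- c * ((1 - y) / p)"]
    by (intro mult_right_mono) auto
  \<comment> \<open>This is what remains of the inequality \<open>*\<close> after the tangent bound
    on the factor \<open>exp (- c * ((1 - y) / p))\<close>. The tangent bound on \<open>E\<close>
    reduces it to \<open>0 \<le> c * y * (c - c * y)\<close>.\<close>
  moreover have "1 - c \<le> (1 - c + c * y) * E"
  proof -
    have "c * y \<le> c * 1" using assms(1) y by (intro mult_left_mono) auto
    then have "0 \<le> c * y * (c - c * y)" using assms(1) y by (intro mult_nonneg_nonneg) auto
    also have "\<dots> = (1 - c + c * y) * (1 - c * y) - (1 - c)" by algebra
    also have "\<dots> \<le> (1 - c + c * y) * E - (1 - c)"
      using exp_ge_add_one_self[of "- c * y"] assms(1,2) y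
      by (intro diff_right_mono mult_left_mono) (auto simp: E_def)
    finally show ?thesis by simp
  qed
  then have "((1 - c) - (1 - c + c * y) * E) / p \<le> 0" using p by (simp add: divide_le_0_iff)
  ultimately have *: "1 - exp (- c * (n / p)) \<le> c / p + (1 - 1 / p) * (1 - E)"
    using p by (simp add: field_simps)
  \<comment> \<open>This makes the coefficient of \<open>D / p\<close> below nonnegative, so that
    \<open>D / p\<close> may be replaced by \<open>r\<close>.\<close>
  have "exp_ratio c y \<le> 1" using exp_ratio_le[OF assms(1), of y] y by simp
  have "D * exp_ratio c (n / p) = D * (1 - exp (- c * (n / p))) / c" by (simp add: exp_ratio_def)
  also have "\<dots> \<le> D * (c / p + (1 - 1 / p) * (1 - E)) / c"
    using * assms by (intro divide_right_mono mult_left_mono) auto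
  also have "\<dots> = D / p * (1 - exp_ratio c y) + D * exp_ratio c y"
    using assms(1) p by (simp add: exp_ratio_def E_def field_simps)
  also have "\<dots> \<le> r * (1 - exp_ratio c y) + D * exp_ratio c y"
    using assms p \<open>exp_ratio c y \<le> 1\<close>
    by (intro add_right_mono mult_right_mono) (auto simp: field_simps)
  finally show ?thesis by (simp add: y_def algebra_simps)
qed

section \<open>Greedy under a cardinality constraint\<close>

lemma submodular_union_le:
  assumes "submodular_on W f" "finite Y" "S \<union> Y \<subseteq> W"
    and "\<And>y. y \<in> Y \<Longrightarrow> f (S \<union> {y}) - f S \<le> r"
  shows "f (S \<union> Y) \<le> f S + real (card Y) * r"
  using assms(2-4)
proof (induction Y)
  case (insert y Y)
  have "f (S \<union> Y \<union> {y}) - f (S \<union> Y) \<le> f (S \<union> {y}) - f S"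
    using insert.prems(1) by (intro submodular_onD[OF assms(1)]) auto
  moreover have "f (S \<union> Y) \<le> f S + real (card Y) * r" using insert by auto
  ultimately show ?case using insert.prems(2)[of y] insert.hyps by (simp add: algebra_simps)
qed simp

text \<open>The gain of the greedy set \<open>S\<close> is split into a part \<open>a\<close> due to elements outside of the reference
  set \<open>X\<close> and the rest. Only the former is discounted by \<open>c\<close> in the deficit \<open>f X - c * a - b\<close>.\<close>

lemma greedy_state_cardinality:
  assumes "greedy_state f {} K d S" and "marginal_ratio W f c" "0 < c" "c \<le> 1"
    and mono: "mono_on (Pow W) f" and sub: "submodular_on W f" and "f {} = 0"
    and "K \<subseteq> W" "X \<subseteq> K" "finite X" "card X = d"
  shows "\<exists>a b. f S = a + b \<and> 0 \<le> a \<and> f X + (1 - c) * a \<le> f (X \<union> S) \<and>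
    (f X * exp_ratio c 1 \<le> f S \<or>
     0 \<le> f X - c * a - b \<and>
     f X * exp_ratio c 1 \<le>
       f S + (f X - c * a - b) * exp_ratio c ((real d - real (card S)) / real (card (X - S))))"
  using assms(1)
proof induction
  case start
  have "0 \<le> f X" using mono_on_PowD[OF mono, of "{}" X] assms(7-9) by auto
  \<comment> \<open>Initially both counts equal \<open>d\<close>, so their quotient is
    \<open>1\<close>, except for \<open>d = 0\<close>, where \<open>X\<close> is empty and
    \<open>f X = 0\<close>.\<close>
  moreover have "exp_ratio c 1 = exp_ratio c (real d / real d)" if "d > 0" using that by simp
  moreover have "f X = 0" if "d = 0" using that assms(7,10,11) by simp
  ultimately show ?case
    using assms(7,11) by (intro exI[of _ 0] conjI) (cases "d = 0"; simp)+
next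
  case (step S x)
  have S: "finite S" "S \<subseteq> K" using greedy_state_card[OF step.hyps(1)] by auto
  have x: "x \<in> K" "x \<notin> S" and max: "\<And>y. y \<in> K - S \<Longrightarrow> f (S \<union> {y}) \<le> f (S \<union> {x})"
    using step.hyps(3) by (auto simp: is_arg_max_def not_less)
  have fX: "0 \<le> f X" using mono_on_PowD[OF mono, of "{}" X] assms(7-9) by auto
  obtain a b where ab: "f S = a + b" "0 \<le> a" "f X + (1 - c) * a \<le> f (X \<union> S)"
    and *: "f X * exp_ratio c 1 \<le> f S \<or> 0 \<le> f X - c * a - b \<and> f X * exp_ratio c 1 \<le>
      f S + (f X - c * a - b) * exp_ratio c ((real d - real (card S)) / real (card (X - S)))"
    using step.IH by blast
  define r where "r = f (S \<union> {x}) - f S"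
  define n where "n = real d - real (card S)"
  define p where "p = real (card (X - S))"
  define D where "D = f X - c * a - b"
  have r0: "0 \<le> r" unfolding r_def
    using mono_on_PowD[OF mono, of S "S \<union> {x}"] S x assms(8) by auto
  have n1: "1 \<le> n" using step.hyps(2) by (simp add: n_def)
  have np: "n \<le> p" unfolding n_def p_def
    using diff_card_le_card_Diff[OF S(1), of X] assms(11) by linarith
  have n': "real d - real (card (S \<union> {x})) = n - 1" using S x by (simp add: n_def)
  \<comment> \<open>Together with the invariant
    \<open>f X + (1 - c) * a \<le> f (X \<union> S)\<close> this bounds the deficit by
    \<open>p * r\<close>.\<close>
  have "f (S \<union> (X - S)) \<le> f S + real (card (X - S)) * r"
    using S assms(8-10) max by (intro submodular_union_le[OF sub]) (auto simp: r_def)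
  then have Dr: "D \<le> p * r" using ab by (simp add: D_def p_def Un_commute algebra_simps)
  have le1: "exp_ratio c 1 \<le> 1" using exp_ratio_le[OF assms(3)] .
  \<comment> \<open>A pick inside \<open>X\<close> leaves \<open>X \<union> S\<close> unchanged: its
    gain goes to \<open>b\<close>, and \<open>n\<close> and \<open>p\<close> both drop by one. The
    gain of a pick outside \<open>X\<close> goes to \<open>a\<close>, only \<open>n\<close> drops,
    and \<open>f (X \<union> S)\<close> grows by at least \<open>(1 - c) * r\<close>.\<close>
  show ?case
  proof (cases "x \<in> X")
    case True
    have "X \<union> (S \<union> {x}) = X \<union> S" using True by auto
    moreover have "card (X - S) = Suc (card (X - (S \<union> {x})))"
    proof -
      have "X - S = insert x (X - (S \<union> {x}))" using True x by auto
      moreover have "card (insert x (X - (S \<union> {x}))) = Suc (card (X - (S \<union> {x})))"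
        using assms(10) by simp
      ultimately show ?thesis by metis
    qed
    then have p': "real (card (X - (S \<union> {x}))) = p - 1" by (simp add: p_def)
    have "f X * exp_ratio c 1 \<le> f (S \<union> {x}) \<or> 0 \<le> f X - c * a - (b + r) \<and> f X * exp_ratio c 1 \<le>
      f (S \<union> {x}) + (f X - c * a - (b + r)) * exp_ratio c ((n - 1) / (p - 1))"
    proof (cases "f X * exp_ratio c 1 \<le> f S \<or> f X - c * a - (b + r) < 0")
      \<comment> \<open>If the new deficit is negative, then
        \<open>f X < c * a + b + r \<le> a + b + r\<close>, which is the new greedy value, so the
        target is reached.\<close>
      case True
      have "f X * exp_ratio c 1 \<le> f X" using fX le1 by (simp add: mult_left_le)
      moreover have "c * a \<le> a" using ab(2) assms(3,4) by (simp add: mult_left_le_one_le)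
      ultimately show ?thesis using True r0 ab(1) by (auto simp: r_def)
    next
      case False
      then have "0 \<le> D" "f X * exp_ratio c 1 \<le> f S + D * exp_ratio c (n / p)"
        using * by (auto simp: D_def n_def p_def)
      moreover have eq: "f X - c * a - (b + r) = D - r" "f (S \<union> {x}) = f S + r"
        by (simp_all add: D_def r_def)
      moreover have "0 \<le> D - r" using False by (simp add: D_def)
      ultimately show ?thesis
        unfolding eq using exp_ratio_step_inside[OF assms(3,4) n1 np _ Dr] by simp
    qed
    moreover have "f (S \<union> {x}) = a + (b + r)" using ab(1) by (simp add: r_def)
    ultimately show ?thesis unfolding n' p' using ab(2,3) by metis
  next
    case False
    have p': "card (X - (S \<union> {x})) = card (X - S)" using False by (intro arg_cong[of _ _ card]) auto
    have "(1 - c) * (f (S \<union> {x}) - f S) \<le> f (X \<union> S \<union> {x}) - f (X \<union> S)"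
      using S x assms(8,9) False by (intro marginal_ratioD[OF assms(2)]) auto
    then have "f X + (1 - c) * (a + r) \<le> f (X \<union> (S \<union> {x}))"
      using ab(3) by (simp add: r_def algebra_simps)
    moreover have "f X * exp_ratio c 1 \<le> f (S \<union> {x}) \<or> 0 \<le> f X - c * (a + r) - b \<and>
      f X * exp_ratio c 1 \<le> f (S \<union> {x}) + (f X - c * (a + r) - b) * exp_ratio c ((n - 1) / p)"
    proof (cases "f X * exp_ratio c 1 \<le> f S \<or> f X - c * (a + r) - b < 0")
      case True
      have "f X * exp_ratio c 1 \<le> f X" using fX le1 by (simp add: mult_left_le)
      moreover have "c * (a + r) \<le> a + r" using ab(2) r0 assms(3,4) by (simp add: mult_left_le_one_le)
      ultimately show ?thesis using True r0 ab(1) by (auto simp: r_def)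
    next
      case False
      then have "0 \<le> D" "f X * exp_ratio c 1 \<le> f S + D * exp_ratio c (n / p)"
        using * by (auto simp: D_def n_def p_def)
      moreover have eq: "f X - c * (a + r) - b = D - c * r" "f (S \<union> {x}) = f S + r"
        by (simp_all add: D_def r_def distrib_left)
      moreover have "0 \<le> D - c * r" using False by (simp add: D_def distrib_left)
      ultimately show ?thesis
        unfolding eq using exp_ratio_step_outside[OF assms(3) _ _ Dr, of n] n1 np by simp
    qed
    moreover have "f (S \<union> {x}) = (a + r) + b" "0 \<le> a + r" using ab(1,2) r0 by (simp_all add: r_def)
    ultimately show ?thesis unfolding n' p' p_def[symmetric] by blast
  qed
qed

lemma greedy_output_cardinality:
  assumes "greedy_output f {} K d S" and "marginal_ratio W f c" "0 < c" "c \<le> 1"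
    and "mono_on (Pow W) f" "submodular_on W f" "f {} = 0"
    and "K \<subseteq> W" "X \<subseteq> K" "finite X" "card X = d"
  shows "curvature_factor c * f X \<le> f S"
proof -
  \<comment> \<open>After \<open>d\<close> picks no steps are left, so the deficit term vanishes and
    both alternatives of the invariant give the bound.\<close>
  have "exp_ratio c 0 = 0" by (simp add: exp_ratio_def)
  then show ?thesis
    using greedy_state_cardinality[OF _ assms(2-11), of S] assms(1,3) greedy_output_card(3)[OF assms(1)]
    by (auto simp: greedy_output_def curvature_factor_def exp_ratio_def mult.commute)
qed

section \<open>Greedy over a sequence of disjoint blocks\<close>

text \<open>The budget of block \<open>s\<close> is given as \<open>card (X s)\<close>, so that
  greedy and reference sets have equal sizes. Monotonicity and submodularity are assumed only in
  \<open>submodular_bound\<close>, so the locale serves both curvatures.\<close>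

locale block_greedy =
  fixes W :: "'a set" and f :: "'a set \<Rightarrow> real" and c :: real
    and K M X :: "nat \<Rightarrow> 'a set" and t :: nat
  assumes ratio: "marginal_ratio W f c" and c1: "c \<le> 1"
    and disjoint: "disjoint_family_on K {1..t}"
    and K: "\<And>s. s \<in> {1..t} \<Longrightarrow> K s \<subseteq> W"
    and X: "\<And>s. s \<in> {1..t} \<Longrightarrow> X s \<subseteq> K s \<and> finite (X s)"
    and greedy: "\<And>s. s \<in> {1..t} \<Longrightarrow> greedy_output f (\<Union>r\<in>{1..<s}. M r) (K s) (card (X s)) (M s)"
begin

lemma M: "s \<in> {1..t} \<Longrightarrow> M s \<subseteq> K s"
  using greedy greedy_output_card(2) by blast

lemma greedy_state_block:
  assumes "s \<in> {1..t}"
  shows "greedy_state f (\<Union>r\<in>{1..<s}. M r) (K s) (card (X s)) (M s)" "card (X s) = card (M s)"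
  using greedy[OF assms] greedy_output_card(3)[OF greedy[OF assms]]
  by (simp_all add: greedy_output_def)

lemma disjoint_block:
  assumes "\<And>r. r \<in> {1..t} \<Longrightarrow> Y r \<subseteq> K r" "n < t"
  shows "(\<Union>r\<in>{1..n}. Y r) \<inter> K (Suc n) = {}"
proof -
  have "Y r \<inter> K (Suc n) = {}" if "r \<in> {1..n}" for r
    using disjoint_family_onD[OF disjoint, of r "Suc n"] assms that by fastforce
  then show ?thesis by blast
qed

lemma Union_subset:
  assumes "\<And>r. r \<in> {1..t} \<Longrightarrow> Y r \<subseteq> K r" "n \<le> t"
  shows "(\<Union>r\<in>{1..n}. Y r) \<subseteq> W"
  using assms K by fastforce

lemma Union_Suc: "(\<Union>r\<in>{1..Suc n}. Y r) = (\<Union>r\<in>{1..n}. Y r) \<union> Y (Suc n)" for Y :: "nat \<Rightarrow> 'a set"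
  by (auto simp: atLeastAtMostSuc_conv)

text \<open>The gains telescope over the blocks: each block is added to the earlier greedy sets on
  one side and to the earlier reference sets on the other.\<close>

lemma marginal_ratio_bound:
  "(1 - c) * (f (\<Union>s\<in>{1..t}. X s) - f {}) \<le> f (\<Union>s\<in>{1..t}. M s) - f {}"
proof -
  have "(1 - c) * (f (\<Union>s\<in>{1..n}. X s) - f {}) \<le> f (\<Union>s\<in>{1..n}. M s) - f {}" if "n \<le> t" for n
    using that
  proof (induction n)
    case (Suc n)
    let ?R = "\<Union>s\<in>{1..n}. M s" and ?Q = "\<Union>s\<in>{1..n}. X s"
    have n: "Suc n \<in> {1..t}" "n < t" "n \<le> t" using Suc.prems by auto
    have st: "greedy_state f ?R (K (Suc n)) (card (X (Suc n))) (M (Suc n))"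
      using greedy_state_block(1)[OF n(1)] by (simp only: atLeastLessThanSuc_atLeastAtMost)
    have "(1 - c) * (f (?Q \<union> X (Suc n)) - f ?Q) \<le> f (?R \<union> M (Suc n)) - f ?R"
    proof (rule greedy_state_marginal_ratio[OF st ratio c1])
      show "K (Suc n) \<union> ?R \<union> ?Q \<subseteq> W" using K[OF n(1)] Union_subset[OF _ n(3)] M X by simp
      show "?R \<inter> K (Suc n) = {}" by (rule disjoint_block[OF M n(2)])
      show "?Q \<inter> K (Suc n) = {}" using X by (intro disjoint_block n) auto
    qed (use X[OF n(1)] greedy_state_block(2)[OF n(1)] in auto)
    moreover have "(1 - c) * (f ?Q - f {}) \<le> f ?R - f {}" using Suc.IH[OF n(3)] .
    ultimately show ?case unfolding Union_Suc by (simp only: right_diff_distrib)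
  qed simp
  then show ?thesis by simp
qed

text \<open>Let \<open>M\<close> and \<open>X\<close> stand for the full unions and \<open>g\<close>
  for the total gain of the picks outside the reference sets. Then
  \<open>f X \<le> f (X \<union> M) - (1 - c) * g\<close> and
  \<open>f (X \<union> M) \<le> f M + g\<close>, hence \<open>f X \<le> f M + c * g\<close>, where
  \<open>g \<le> f M\<close>.\<close>

lemma submodular_bound:
  assumes mono: "mono_on (Pow W) f" and sub: "submodular_on W f" and "f {} = 0" "0 \<le> c"
  shows "f (\<Union>s\<in>{1..t}. X s) \<le> (1 + c) * f (\<Union>s\<in>{1..t}. M s)"
proof -
  let ?M = "\<lambda>n. \<Union>s\<in>{1..n}. M s" and ?X = "\<lambda>n. \<Union>s\<in>{1..n}. X s"
  have XK: "\<And>r. r \<in> {1..t} \<Longrightarrow> X r \<subseteq> K r" using X by blast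
  \<comment> \<open>The induction adds block after block to the fixed full unions
    \<open>?M t\<close> and \<open>?X t\<close>, and \<open>g\<close> accumulates the witnesses of
    \<open>greedy_state_submodular\<close>.\<close>
  have "\<exists>g. g \<le> f (?M n) \<and> f (?M t \<union> ?X n) - f (?M t) \<le> g \<and> (1 - c) * g \<le> f (?X t \<union> ?M n) - f (?X t)"
    if "n \<le> t" for n
    using that
  proof (induction n)
    case 0
    then show ?case using assms(3) by (intro exI[of _ 0]) simp
  next
    case (Suc n)
    have n: "Suc n \<in> {1..t}" "n < t" "n \<le> t" using Suc.prems by auto
    obtain g where g: "g \<le> f (?M n)" "f (?M t \<union> ?X n) - f (?M t) \<le> g"
      "(1 - c) * g \<le> f (?X t \<union> ?M n) - f (?X t)"
      using Suc by auto
    have st: "greedy_state f (?M n) (K (Suc n)) (card (X (Suc n))) (M (Suc n))"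
      using greedy_state_block(1)[OF n(1)] by (simp only: atLeastLessThanSuc_atLeastAtMost)
    have W: "K (Suc n) \<union> ?M n \<subseteq> W" using K[OF n(1)] Union_subset[OF M n(3)] by simp
    have "\<exists>h. h \<le> f (?M n \<union> M (Suc n)) - f (?M n) \<and>
      (\<forall>Z. ?M n \<union> M (Suc n) \<subseteq> Z \<longrightarrow> Z \<subseteq> W \<longrightarrow> f (Z \<union> X (Suc n)) - f Z \<le> h) \<and>
      (\<forall>Y. Y \<subseteq> W \<longrightarrow> Y \<inter> M (Suc n) \<subseteq> X (Suc n) \<longrightarrow> (1 - c) * h \<le> f (Y \<union> M (Suc n)) - f Y)"
      using X[OF n(1)] greedy_state_block(2)[OF n(1)]
      by (intro greedy_state_submodular[OF st ratio c1 mono sub W disjoint_block[OF M n(2)]]) auto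
    then obtain h where h: "h \<le> f (?M n \<union> M (Suc n)) - f (?M n)"
      and hZ: "\<And>Z. ?M n \<union> M (Suc n) \<subseteq> Z \<Longrightarrow> Z \<subseteq> W \<Longrightarrow> f (Z \<union> X (Suc n)) - f Z \<le> h"
      and hY: "\<And>Y. Y \<subseteq> W \<Longrightarrow> Y \<inter> M (Suc n) \<subseteq> X (Suc n) \<Longrightarrow> (1 - c) * h \<le> f (Y \<union> M (Suc n)) - f Y"
      by blast
    have "f (?M t \<union> ?X n \<union> X (Suc n)) - f (?M t \<union> ?X n) \<le> h"
    proof (rule hZ)
      have "?M (Suc n) \<subseteq> ?M t" using n(1) by (intro UN_mono) auto
      then show "?M n \<union> M (Suc n) \<subseteq> ?M t \<union> ?X n" unfolding Union_Suc by blast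
      show "?M t \<union> ?X n \<subseteq> W" using Union_subset[OF M order_refl] Union_subset[OF XK n(3)] by blast
    qed
    moreover have "(1 - c) * h \<le> f (?X t \<union> ?M n \<union> M (Suc n)) - f (?X t \<union> ?M n)"
    proof (rule hY)
      show "?X t \<union> ?M n \<subseteq> W" using Union_subset[OF XK order_refl] Union_subset[OF M n(3)] by blast
      \<comment> \<open>Reference sets of other blocks are disjoint from \<open>K (Suc n)\<close>,
        so only \<open>X (Suc n)\<close> can meet the greedy set of this block.\<close>
      have "X r \<inter> M (Suc n) \<subseteq> X (Suc n)" if "r \<in> {1..t}" for r
        using disjoint_family_onD[OF disjoint that n(1)] XK[OF that] M[OF n(1)] by blast
      then show "(?X t \<union> ?M n) \<inter> M (Suc n) \<subseteq> X (Suc n)"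
        using disjoint_block[OF M n(2)] M[OF n(1)] by blast
    qed
    ultimately have "g + h \<le> f (?M (Suc n)) \<and> f (?M t \<union> ?X (Suc n)) - f (?M t) \<le> g + h \<and>
      (1 - c) * (g + h) \<le> f (?X t \<union> ?M (Suc n)) - f (?X t)"
      unfolding Union_Suc using g h by (simp only: Un_assoc distrib_left) linarith
    then show ?case by blast
  qed
  then obtain g where g: "g \<le> f (?M t)" "f (?M t \<union> ?X t) - f (?M t) \<le> g"
    "(1 - c) * g \<le> f (?X t \<union> ?M t) - f (?X t)"
    by blast
  then have "f (?X t) \<le> f (?M t) + c * g" by (simp add: Un_commute algebra_simps)
  also have "c * g \<le> c * f (?M t)" using g(1) assms(4) by (rule mult_left_mono)
  finally show ?thesis by (simp add: algebra_simps)
qed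

end

section \<open>The guarantees for the robust algorithm\<close>

theorem theorem12:
  fixes f :: "'a set \<Rightarrow> real" and V :: "nat \<Rightarrow> 'a set" and \<alpha> \<beta> :: "nat \<Rightarrow> nat" and T :: nat
    and S1 S2 A B M :: "nat \<Rightarrow> 'a set"
  assumes "T \<ge> 1"
    and "\<And>t. t \<in> {1..T} \<Longrightarrow> finite (V t)"
    and "disjoint_family_on V {1..T}"
    and "mono_on (Pow (ground V T)) f"
    and "f {} = 0"
    and "\<And>t. t \<in> {1..T} \<Longrightarrow> \<beta> t \<le> \<alpha> t \<and> \<alpha> t \<le> card (V t)"
    and "\<And>t. t \<in> {1..T} \<Longrightarrow> ram_step f V \<alpha> \<beta> S1 S2 A B t"
    and "\<And>t. t \<in> {1..T} \<Longrightarrow> worst_case_removal f \<beta> A B t"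
    and "\<And>t. t \<in> {1..T} \<Longrightarrow> failure_free_greedy f V \<alpha> \<beta> S1 M t"
  shows "\<forall>t\<in>{1..T}.
    card (A t) \<le> \<alpha> t \<and>
    (rsm_opt f V \<alpha> \<beta> t > 0 \<longrightarrow> f (\<Union>s\<in>{1..t}. M s) > 0 \<longrightarrow>
      (submodular_on (ground V T) f \<longrightarrow> (\<forall>v\<in>ground V T. f {v} \<noteq> 0) \<longrightarrow>
        f (\<Union>s\<in>{1..t}. A s - B s) / rsm_opt f V \<alpha> \<beta> t \<ge>
          (if t = 1
           then curvature_factor (curvature (ground V T) f) * (f (A 1 - B 1) / f (M 1))
           else 1 / (1 + curvature (ground V T) f) *
                (f (\<Union>s\<in>{1..t}. A s - B s) / f (\<Union>s\<in>{1..t}. M s)))) \<and>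
      f (\<Union>s\<in>{1..t}. A s - B s) / rsm_opt f V \<alpha> \<beta> t \<ge>
        (1 - total_curvature (ground V T) f) *
        (f (\<Union>s\<in>{1..t}. A s - B s) / f (\<Union>s\<in>{1..t}. M s)))"
proof (intro ballI conjI impI)
  let ?W = "ground V T"
  fix t assume t: "t \<in> {1..T}"
  have W: "V s \<subseteq> ?W" if "s \<in> {1..T}" for s using that by (auto simp: ground_def)
  have S1: "S1 s \<subseteq> V s" "finite (S1 s)" "card (S1 s) \<le> \<beta> s" if "s \<in> {1..T}" for s
  proof -
    have "top_singletons f (V s) (\<beta> s) (S1 s)" using assms(7)[OF that] by (simp add: ram_step_def)
    from top_singletons_card[OF this]
    show "S1 s \<subseteq> V s" "finite (S1 s)" "card (S1 s) \<le> \<beta> s" .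
  qed
  have A: "A s = S1 s \<union> S2 s" "S2 s \<subseteq> V s - S1 s" "card (S2 s) = \<alpha> s - \<beta> s" if "s \<in> {1..T}" for s
  proof -
    have "greedy_output f (\<Union>r\<in>{1..<s}. A r - B r) (V s - S1 s) (\<alpha> s - \<beta> s) (S2 s)"
      using assms(7)[OF that] by (simp add: ram_step_def)
    from greedy_output_card(2,3)[OF this]
    show "S2 s \<subseteq> V s - S1 s" "card (S2 s) = \<alpha> s - \<beta> s" .
    show "A s = S1 s \<union> S2 s" using assms(7)[OF that] by (simp add: ram_step_def)
  qed
  show "card (A t) \<le> \<alpha> t"
    using card_Un_le[of "S1 t" "S2 t"] A[OF t] S1[OF t] assms(6)[OF t] by simp
  assume opt: "rsm_opt f V \<alpha> \<beta> t > 0" and Mpos: "f (\<Union>s\<in>{1..t}. M s) > 0"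
  obtain X where X: "\<And>r. r \<in> {1..t} \<Longrightarrow> X r \<subseteq> V r - S1 r \<and> card (X r) = \<alpha> r - \<beta> r"
    and optX: "rsm_opt f V \<alpha> \<beta> t \<le> f (\<Union>r\<in>{1..t}. X r)"
  proof -
    have "\<exists>X. (\<forall>r\<in>{1..<1 + t}. X r \<subseteq> V r - S1 r \<and> card (X r) = \<alpha> r - \<beta> r) \<and>
             rsm_value f V \<alpha> \<beta> t 1 {} \<le> f ({} \<union> (\<Union>r\<in>{1..<1 + t}. X r))"
    proof (rule rsm_value_le)
      fix r assume "r \<in> {1..<1 + t}"
      then have "r \<in> {1..T}" using t by auto
      then show "finite (V r) \<and> finite (S1 r) \<and> card (S1 r) \<le> \<beta> r \<and> \<beta> r \<le> \<alpha> r \<and> \<alpha> r \<le> card (V r)"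
        using assms(2,6) S1 by blast
    qed
    moreover have "{1..<1 + t} = {1..t}" by auto
    ultimately show ?thesis using that unfolding rsm_opt_def by (simp only: Un_empty_left) metis
  qed
  have finW: "finite ?W" using assms(2) by (auto simp: ground_def)
  have finX: "finite (X s)" if "s \<in> {1..t}" for s
    using X[OF that] assms(2)[of s] that t finite_subset[of "X s" "V s"] by auto
  have block: "block_greedy ?W f c (\<lambda>s. V s - S1 s) M X t" if "marginal_ratio ?W f c" "c \<le> 1" for c
  proof
    show "disjoint_family_on (\<lambda>s. V s - S1 s) {1..t}"
    proof (rule disjoint_family_on_bisimulation)
      show "disjoint_family_on V {1..t}" using disjoint_family_on_mono[OF _ assms(3)] t by simp
    qed auto
    show "greedy_output f (\<Union>r\<in>{1..<s}. M r) (V s - S1 s) (card (X s)) (M s)" if "s \<in> {1..t}" for s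
      using assms(9)[of s] X[OF that] that t by (simp add: failure_free_greedy_def)
    show "(V s - S1 s) \<subseteq> ?W" if "s \<in> {1..t}" for s using W[of s] that t by auto
    show "X s \<subseteq> V s - S1 s \<and> finite (X s)" if "s \<in> {1..t}" for s using X finX that by blast
  qed (fact that)+
  let ?F = "f (\<Union>s\<in>{1..t}. A s - B s)" and ?FM = "f (\<Union>s\<in>{1..t}. M s)"
  have MW: "(\<Union>s\<in>{1..t}. M s) \<subseteq> ?W"
  proof -
    have "M s \<subseteq> V s" if "s \<in> {1..T}" for s
      using assms(9)[OF that] greedy_output_card(2) unfolding failure_free_greedy_def by blast
    then have "M s \<subseteq> ?W" if "s \<in> {1..t}" for s using W[of s] that t by fastforce
    then show ?thesis by blast
  qed
  have F0: "0 \<le> ?F"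
  proof -
    have "A s - B s \<subseteq> ?W" if "s \<in> {1..t}" for s
      using A(1,2)[of s] S1(1)[of s] W[of s] that t by auto
    then have "(\<Union>s\<in>{1..t}. A s - B s) \<subseteq> ?W" by blast
    then show ?thesis using mono_on_PowD[OF assms(4), of "{}"] assms(5) by fastforce
  qed
  \<comment> \<open>Any greedy guarantee with factor \<open>k\<close> yields a ratio bound:
    \<open>k\<close> times the optimal value is at most \<open>?FM\<close>, and multiplying by
    \<open>?F \<ge> 0\<close> gives the claim.\<close>
  have final: "k * (?F / ?FM) \<le> ?F / rsm_opt f V \<alpha> \<beta> t"
    if k: "0 \<le> k" "k * f (\<Union>s\<in>{1..t}. X s) \<le> ?FM" for k
  proof -
    have "k * rsm_opt f V \<alpha> \<beta> t \<le> ?FM"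
      using mult_left_mono[OF optX k(1)] k(2) by simp
    then have "?F * (k * rsm_opt f V \<alpha> \<beta> t) \<le> ?F * ?FM" using F0 by (rule mult_left_mono)
    then show ?thesis using opt Mpos by (simp add: field_simps)
  qed
  show "?F / rsm_opt f V \<alpha> \<beta> t \<ge> (1 - total_curvature ?W f) * (?F / ?FM)"
  proof -
    \<comment> \<open>The positive value of the greedy sets shows that \<open>f\<close> is not
      constant, as the total curvature requires.\<close>
    have "\<exists>X\<subseteq>?W. f X \<noteq> f {}" using MW Mpos assms(5) by (intro exI[of _ "\<Union>s\<in>{1..t}. M s"]) simp
    note r = marginal_ratio_total_curvature[OF finW assms(4) this]
    show ?thesis
      using block_greedy.marginal_ratio_bound[OF block[OF r]] r(2) assms(5) by (intro final) auto
  qed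
  assume sub: "submodular_on ?W f" and nz: "\<forall>v\<in>?W. f {v} \<noteq> 0"
  define \<kappa> where "\<kappa> = curvature ?W f"
  have "?W \<noteq> {}" using MW Mpos assms(5) by auto
  note \<kappa> = curvature_bounds[OF finW this assms(4) sub assms(5) nz, folded \<kappa>_def]
  have bound: "f (\<Union>s\<in>{1..t}. X s) \<le> (1 + \<kappa>) * ?FM"
    using block_greedy.submodular_bound[OF block[OF \<kappa>(3,2)] assms(4) sub assms(5) \<kappa>(1)] .
  have factor: "0 \<le> curvature_factor \<kappa>" using \<kappa>(1) by (simp add: curvature_factor_def)
  have "?F / rsm_opt f V \<alpha> \<beta> t \<ge> curvature_factor \<kappa> * (?F / ?FM)" if "t = 1"
  proof (rule final[OF factor])
    show "curvature_factor \<kappa> * f (\<Union>s\<in>{1..t}. X s) \<le> ?FM"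
    proof (cases "\<kappa> = 0")
      \<comment> \<open>The exponential analysis divides by \<open>\<kappa>\<close>; for
        \<open>\<kappa> = 0\<close> the factor is \<open>1\<close>, and the block bound with
        \<open>1 + \<kappa> = 1\<close> gives it.\<close>
      case True
      then show ?thesis using bound by (simp add: curvature_factor_def)
    next
      case False
      have "greedy_output f {} (V 1 - S1 1) (\<alpha> 1 - \<beta> 1) (M 1)"
        using assms(9)[of 1] t that by (simp add: failure_free_greedy_def)
      moreover have "0 < \<kappa>" using False \<kappa>(1) by simp
      moreover have "V 1 - S1 1 \<subseteq> ?W" using W[of 1] t that by auto
      ultimately have "curvature_factor \<kappa> * f (X 1) \<le> f (M 1)"
        using greedy_output_cardinality[OF _ \<kappa>(3) _ \<kappa>(2) assms(4) sub assms(5)] X[of 1] finX[of 1] that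
        by simp
      then show ?thesis using that by simp
    qed
  qed
  moreover have "?F / rsm_opt f V \<alpha> \<beta> t \<ge> 1 / (1 + \<kappa>) * (?F / ?FM)"
    using bound \<kappa>(1) by (intro final) (auto simp: field_simps)
  ultimately show "?F / rsm_opt f V \<alpha> \<beta> t \<ge>
      (if t = 1 then curvature_factor (curvature ?W f) * (f (A 1 - B 1) / f (M 1))
       else 1 / (1 + curvature ?W f) * (?F / ?FM))"
    unfolding \<kappa>_def[symmetric] by (cases "t = 1") simp_all
qed

end
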